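(* Let $q\in\mathbb{C}$ with $0<|q|<1$, let $b\in\mathbb{C}$, and let $x,y\in\mathbb{C}\setminus\{0\}$ with $|q/(xy)|<1$ and $x,y\notin\{q^m: m\ge 1\}$. Let $(\alpha_n)_{n\in\mathbb{Z}}$, $(\beta_n)_{n\ge 0}$ be complex sequences forming an asymmetric bilateral Bailey pair with $a=1$, $\lambda=1$, i.e. $$\beta_n=\sum_{k=-n-1}^{n}\frac{\alpha_k}{(q)_{n-k}(q)_{n+k+1}}\qquad(n\ge 0),$$ and such that both series below converge absolutely. Then $$\sum_{n=0}^{\infty}(x)_n(y)_n(1-bq^n)\Big(\frac{q}{xy}\Big)^{n}\beta_n=\frac{(q/x)_\infty(q/y)_\infty}{(q)_\infty(q/(xy))_\infty}\sum_{n=-\infty}^{\infty}\frac{(x)_n(y)_n\,(q/(xy))^n}{(q/x)_n(q/y)_n}\left(\frac{1-bq^n}{1-q^{2n+1}}\,\alpha_n-\frac{q^{n-1}(q^n-b)}{1-q^{2n-1}}\,\alpha_{n-1}\right).$$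
   Context: $(a)_n=(a;q)_n=\prod_{j=1}^{n}(1-aq^{j-1})$ for $n\ge 0$ (with $(a)_0=1$), $(a)_\infty=(a;q)_\infty=\prod_{j\ge 0}(1-aq^j)$. For negative indices, $(a)_{-m}=1/\prod_{j=1}^{m}(1-aq^{-j})$ for $m\ge1$, and $1/(a)_{-m}$ denotes $\prod_{j=1}^{m}(1-aq^{-j})$ (which may be $0$). *)

theory Defs
  imports "HOL-Analysis.Infinite_Sum" "HOL-Analysis.Infinite_Products"
begin

text \<open>
  For a negative index, \<open>qpoch a q (- m)\<close> is the reciprocal of
  \<open>\<Prod>j=1..m. 1 - a * q powi (- j)\<close>. Since \<open>inverse 0 = 0\<close>, the expression
  \<open>1 / qpoch a q (- m)\<close> equals that product in every case, including when it vanishes;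
  this is the usual convention for \<open>1 / (a; q)\<close> with index \<open>- m\<close>.
\<close>

definition qpoch :: "complex \<Rightarrow> complex \<Rightarrow> int \<Rightarrow> complex" where
  "qpoch a q n =
     (if n \<ge> 0 then \<Prod>j=1..nat n. 1 - a * q ^ (j - 1)
      else 1 / (\<Prod>j=1..nat (- n). 1 - a * q powi (- int j)))"

definition qpoch_inf :: "complex \<Rightarrow> complex \<Rightarrow> complex" where
  "qpoch_inf a q = (\<Prod>j. 1 - a * q ^ j)"

text \<open>The parameters are \<open>a = 1\<close> and \<open>\<lambda> = 1\<close>.\<close>

definition asym_bilateral_Bailey_pair ::
    "complex \<Rightarrow> (int \<Rightarrow> complex) \<Rightarrow> (nat \<Rightarrow> complex) \<Rightarrow> bool" where
  "asym_bilateral_Bailey_pair q \<alpha> \<beta> \<longleftrightarrow>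
     (\<forall>n. \<beta> n = (\<Sum>k = - int n - 1..int n.
        \<alpha> k / (qpoch q q (int n - k) * qpoch q q (int n + k + 1))))"

end

theory Submission
  imports Defs "HOL-Analysis.Uniform_Limit"
begin

text \<open>
  Put \<open>A k = \<alpha> k + \<alpha> (- k - 1)\<close> for \<open>k \<ge> 0\<close>. Then \<open>(A, \<beta>)\<close> is an ordinary Bailey pair relative
  to \<open>q\<close>. The weight on the right-hand side is even in \<open>n\<close>, and adding the terms at \<open>n\<close> and \<open>- n\<close>
  turns the bracket into a sequence that forms a Bailey pair relative to \<open>1\<close> with
  \<open>(1 - b * q ^ n) * \<beta> n\<close>. The claim is therefore the limiting Bailey lemma: interchange the two
  sums and evaluate the inner one by the \<open>q\<close>-Gauss sum. Absolute convergence of the double series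
  already follows from that of the right-hand side.
\<close>

section \<open>The $q$-Gauss sum\<close>

definition qpochn :: "complex \<Rightarrow> complex \<Rightarrow> nat \<Rightarrow> complex" where
  "qpochn a q n = (\<Prod>j<n. 1 - a * q ^ j)"

lemma qpochn_0 [simp]: "qpochn a q 0 = 1"
  and qpochn_Suc: "qpochn a q (Suc n) = qpochn a q n * (1 - a * q ^ n)"
  by (simp_all add: qpochn_def)

lemma qpoch_of_nat: "qpoch a q (int n) = qpochn a q n"
proof -
  have "(\<Prod>j=1..n. 1 - a * q ^ (j - 1)) = (\<Prod>j<n. 1 - a * q ^ j)"
    by (rule prod.reindex_bij_witness[of _ Suc "\<lambda>j. j - 1"]) auto
  then show ?thesis
    by (simp add: qpoch_def qpochn_def)
qed

lemma qpochn_add: "qpochn a q (m + n) = qpochn a q m * qpochn (a * q ^ m) q n"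
  by (induction n) (simp_all add: qpochn_Suc power_add mult_ac)

lemma qpochn_nonzero: "(\<And>j. a * q ^ j \<noteq> 1) \<Longrightarrow> qpochn a q n \<noteq> 0"
  by (simp add: qpochn_def)

lemma q_power_neq_1:
  fixes q :: complex
  assumes "norm q < 1"
  shows "q * q ^ j \<noteq> 1"
proof
  assume "q * q ^ j = 1"
  then have "norm q ^ Suc j = 1"
    by (metis norm_one norm_power power_Suc)
  then show False
    using assms power_Suc_less_one[of "norm q" j] by (cases "norm q = 0") auto
qed

text \<open>Each factor is estimated by \<open>1 + t \<le> exp t\<close>, and the exponents form a
  geometric series. The bound involves neither \<open>n\<close> nor the phase of \<open>a\<close>,
  so it also serves every \<open>a * q ^ k\<close>.\<close>

lemma norm_qpochn_le:
  assumes "norm q < 1" "norm a \<le> r"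
  shows "norm (qpochn a q n) \<le> exp (r / (1 - norm q))"
proof -
  have r: "r \<ge> 0"
    using assms(2) norm_ge_zero order_trans by blast
  have "norm (qpochn a q n) = (\<Prod>j<n. norm (1 - a * q ^ j))"
    by (simp add: qpochn_def prod_norm)
  also have "\<dots> \<le> (\<Prod>j<n. exp (r * norm q ^ j))"
  proof (intro prod_mono conjI)
    fix j
    have "norm (1 - a * q ^ j) \<le> 1 + norm a * norm q ^ j"
      by (metis norm_mult norm_one norm_power norm_triangle_ineq4)
    also have "\<dots> \<le> 1 + r * norm q ^ j"
      using assms by (simp add: mult_right_mono)
    also have "\<dots> \<le> exp (r * norm q ^ j)"
      by (rule exp_ge_add_one_self)
    finally show "norm (1 - a * q ^ j) \<le> exp (r * norm q ^ j)" .
  qed auto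
  also have "\<dots> = exp (r * (\<Sum>j<n. norm q ^ j))"
    by (simp add: exp_sum sum_distrib_left)
  also have "(\<Sum>j<n. norm q ^ j) \<le> (\<Sum>j. norm q ^ j)"
    using assms(1) by (intro sum_le_suminf summable_geometric) auto
  also have "(\<Sum>j. norm q ^ j) = 1 / (1 - norm q)"
    using assms(1) by (intro suminf_geometric) auto
  finally show ?thesis
    using r by (simp add: mult_left_mono)
qed

lemma convergent_prod_qpoch:
  fixes a q :: complex
  assumes "norm q < 1"
  shows "convergent_prod (\<lambda>j. 1 - a * q ^ j)"
proof -
  have "summable (\<lambda>j. norm a * norm q ^ j)"
    using assms by (intro summable_mult summable_geometric) auto
  then show ?thesis
    by (intro abs_convergent_prod_imp_convergent_prod summable_imp_abs_convergent_prod)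
       (simp add: norm_mult norm_power)
qed

lemma qpochn_tendsto:
  assumes "norm q < 1"
  shows "qpochn a q \<longlonglongrightarrow> qpoch_inf a q"
proof -
  have "(\<lambda>j. 1 - a * q ^ j) has_prod qpoch_inf a q"
    unfolding qpoch_inf_def by (rule convergent_prod_has_prod[OF convergent_prod_qpoch[OF assms]])
  from has_prod_imp_tendsto'[OF this] show ?thesis
    by (simp add: qpochn_def[abs_def])
qed

lemma qpoch_inf_split:
  assumes "norm q < 1"
  shows "qpoch_inf a q = qpochn a q n * qpoch_inf (a * q ^ n) q"
proof (rule LIMSEQ_unique)
  show "(\<lambda>m. qpochn a q (m + n)) \<longlonglongrightarrow> qpoch_inf a q"
    by (rule LIMSEQ_ignore_initial_segment[OF qpochn_tendsto[OF assms]])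
  have "(\<lambda>m. qpochn a q n * qpochn (a * q ^ n) q m) \<longlonglongrightarrow> qpochn a q n * qpoch_inf (a * q ^ n) q"
    by (intro tendsto_mult tendsto_const qpochn_tendsto assms)
  then show "(\<lambda>m. qpochn a q (m + n)) \<longlonglongrightarrow> qpochn a q n * qpoch_inf (a * q ^ n) q"
    by (simp add: qpochn_add add.commute[of _ n])
qed

lemma qpoch_inf_nonzero:
  assumes "norm q < 1" "\<And>j. a * q ^ j \<noteq> 1"
  shows "qpoch_inf a q \<noteq> 0"
proof -
  have nz: "1 - a * q ^ j \<noteq> 0" for j
    using assms(2)[of j] by simp
  show ?thesis
    unfolding qpoch_inf_def
    using prodinf_nonzero[OF convergent_prod_qpoch[OF assms(1)] nz] .
qed

text \<open>The reciprocals converge because the limit is nonzero, hence they are bounded; the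
  constant is the inverse of that bound.\<close>

lemma norm_qpochn_lower_bound:
  assumes "norm q < 1" "\<And>j. a * q ^ j \<noteq> 1"
  obtains c where "c > 0" "\<And>n. c \<le> norm (qpochn a q n)"
proof -
  have "(\<lambda>n. inverse (qpochn a q n)) \<longlonglongrightarrow> inverse (qpoch_inf a q)"
    using assms by (intro tendsto_inverse qpochn_tendsto qpoch_inf_nonzero)
  then have "Bseq (\<lambda>n. inverse (qpochn a q n))"
    by (rule convergent_imp_Bseq[OF convergentI])
  then obtain K where K: "K > 0" "\<And>n. norm (inverse (qpochn a q n)) \<le> K"
    by (auto simp: Bseq_def)
  have "inverse K \<le> norm (qpochn a q n)" for n
    using K(2)[of n] K(1) qpochn_nonzero[OF assms(2), of n]
    by (simp add: norm_inverse) (metis inverse_inverse_eq inverse_positive_iff_positive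
        le_imp_inverse_le norm_inverse zero_less_norm_iff)
  then show ?thesis
    using K(1) by (intro that[of "inverse K"]) auto
qed

section \<open>The \<open>q\<close>-Gauss series\<close>

text \<open>The \<open>m\<close>-th term of the basic hypergeometric series 2phi1 with upper
  parameters \<open>a\<close>, \<open>b\<close>, lower parameter \<open>c\<close> and argument
  \<open>c / (a * b)\<close>.\<close>

definition qgauss_term :: "complex \<Rightarrow> complex \<Rightarrow> complex \<Rightarrow> complex \<Rightarrow> nat \<Rightarrow> complex" where
  "qgauss_term q a b c m =
     qpochn a q m * qpochn b q m * (c / (a * b)) ^ m / (qpochn q q m * qpochn c q m)"

text \<open>Uniformity in \<open>N\<close> is the point: the case \<open>N = 0\<close> gives
  summability, and the full bound is the majorant for the limit of large \<open>N\<close> in the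
  \<open>q\<close>-Gauss sum.\<close>

lemma norm_qgauss_term_le:
  assumes "norm q < 1" "\<And>j. c * q ^ j \<noteq> 1"
  obtains K where "\<And>N m. norm (qgauss_term q a b (c * q ^ N) m) \<le> K * norm (c / (a * b)) ^ m"
proof -
  obtain c1 where c1: "c1 > 0" "\<And>n. c1 \<le> norm (qpochn q q n)"
    using norm_qpochn_lower_bound[OF assms(1) q_power_neq_1[OF assms(1)]] by blast
  obtain c2 where c2: "c2 > 0" "\<And>n. c2 \<le> norm (qpochn c q n)"
    using norm_qpochn_lower_bound[OF assms] by blast
  define u where "u r = exp (r / (1 - norm q))" for r
  have u: "norm (qpochn d q n) \<le> u (norm d)" for d n
    unfolding u_def using norm_qpochn_le[OF assms(1)] by simp
  have u_pos: "u r > 0" for r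
    by (simp add: u_def)
  \<comment> \<open>Splitting \<open>qpochn c q (N + m)\<close> at \<open>N\<close> and dividing its
    lower bound by the upper bound of the first factor bounds the second from below, uniformly in
    \<open>N\<close> and \<open>m\<close>.\<close>
  define c3 where "c3 = c2 / u (norm c)"
  have c3: "c3 > 0" "c3 \<le> norm (qpochn (c * q ^ N) q m)" for N m
  proof -
    show "c3 > 0"
      using c2 u_pos by (simp add: c3_def)
    have "c2 \<le> norm (qpochn c q N) * norm (qpochn (c * q ^ N) q m)"
      using c2(2)[of "N + m"] by (simp add: qpochn_add norm_mult)
    also have "\<dots> \<le> u (norm c) * norm (qpochn (c * q ^ N) q m)"
      by (intro mult_right_mono u) auto
    finally show "c3 \<le> norm (qpochn (c * q ^ N) q m)"
      using u_pos[of "norm c"] by (simp add: c3_def field_simps)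
  qed
  have "norm (qgauss_term q a b (c * q ^ N) m)
          \<le> u (norm a) * u (norm b) / (c1 * c3) * norm (c / (a * b)) ^ m" for N m
  proof -
    have "norm (c * q ^ N / (a * b)) \<le> norm (c / (a * b)) * 1"
      unfolding times_divide_eq_left[symmetric] norm_mult norm_divide norm_power
      using assms(1) by (simp add: divide_right_mono mult_left_le power_le_one)
    then have "norm (qgauss_term q a b (c * q ^ N) m)
          \<le> u (norm a) * u (norm b) * norm (c / (a * b)) ^ m / (c1 * c3)"
      unfolding qgauss_term_def norm_mult norm_divide[of "_ * _"] norm_power
      using c1 c3 u u_pos
      by (intro frac_le mult_mono power_mono mult_pos_pos mult_nonneg_nonneg)
         (auto simp: norm_mult norm_divide norm_power less_imp_le)
    then show ?thesis
      by simp
  qed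
  then show ?thesis
    by (rule that)
qed

lemma summable_norm_qgauss_term:
  assumes "norm q < 1" "\<And>j. c * q ^ j \<noteq> 1" "norm (c / (a * b)) < 1"
  shows "summable (\<lambda>m. norm (qgauss_term q a b c m))"
proof -
  obtain K where "\<And>N m. norm (qgauss_term q a b (c * q ^ N) m) \<le> K * norm (c / (a * b)) ^ m"
    using norm_qgauss_term_le[OF assms(1,2)] by blast
  from this[of 0] have "norm (norm (qgauss_term q a b c m)) \<le> K * norm (c / (a * b)) ^ m" for m
    by simp
  then show ?thesis
    using assms(3) by (intro summable_comparison_test'[OF summable_mult[OF summable_geometric]]) auto
qed

text \<open>Replacing \<open>c\<close> by \<open>c * q\<close> removes the leading factor from each
  of the four infinite products in the evaluation. The difference of the two sides telescopes
  termwise, so the product formula is not presupposed.\<close>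

lemma qgauss_contiguous:
  assumes q: "norm q < 1" and c: "\<And>j. c * q ^ j \<noteq> 1" and ab: "a \<noteq> 0" "b \<noteq> 0"
    and z: "norm (c / (a * b)) < 1"
  shows "(1 - c) * (1 - c / (a * b)) * (\<Sum>m. qgauss_term q a b c m) =
    (1 - c / a) * (1 - c / b) * (\<Sum>m. qgauss_term q a b (c * q) m)"
proof -
  define t where "t = qgauss_term q a b c"
  define t' where "t' = qgauss_term q a b (c * q)"
  \<comment> \<open>telescoping certificate for the difference of the two sides\<close>
  define G where "G m = (q ^ m - 1) * (1 - c) * t m" for m
  have t: "summable t"
    unfolding t_def by (rule summable_norm_cancel[OF summable_norm_qgauss_term[OF q c z]])
  have c': "c * q * q ^ j \<noteq> 1" for j
    using c[of "Suc j"] by (simp add: mult.assoc)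
  have "norm (c * q / (a * b)) \<le> norm (c / (a * b)) * 1"
    unfolding times_divide_eq_left[symmetric] norm_mult norm_divide
    using q by (simp add: divide_right_mono mult_left_le)
  then have z': "norm (c * q / (a * b)) < 1"
    using z by simp
  have t': "summable t'"
    unfolding t'_def by (rule summable_norm_cancel[OF summable_norm_qgauss_term[OF q c' z']])
  \<comment> \<open>Everything is \<open>s\<close>, the value of \<open>t m\<close>, times a
    rational function of \<open>Q = q ^ m\<close>. The factor \<open>q ^ Suc m - 1\<close> of
    \<open>G (Suc m)\<close> cancels, up to sign, the new factor \<open>1 - q * Q\<close> in the
    denominator of \<open>t (Suc m)\<close>.\<close>
  have step: "(1 - c) * (1 - c / (a * b)) * t m - (1 - c / a) * (1 - c / b) * t' m
                = G (Suc m) - G m" for m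
  proof -
    define Q where "Q = q ^ m"
    define s where "s = qpochn a q m * qpochn b q m * (c / (a * b)) ^ m
                          / (qpochn q q m * qpochn c q m)"
    have nz: "1 - c * Q \<noteq> 0" "1 - q * Q \<noteq> 0" "1 - c \<noteq> 0"
      using c[of m] c[of 0] q_power_neq_1[OF q, of m] by (auto simp: Q_def)
    have c'm: "qpochn (c * q) q m = qpochn c q m * (1 - c * Q) / (1 - c)"
      using qpochn_add[of c q 1 m] nz
      by (simp add: qpochn_Suc[of c q m] qpochn_Suc[of c q 0, simplified] Q_def field_simps)
    have t'm: "t' m = s * Q * (1 - c) / (1 - c * Q)"
      by (simp add: t'_def qgauss_term_def c'm s_def Q_def power_mult_distrib power_divide mult_ac)
    have tS: "t (Suc m) = s * (1 - a * Q) * (1 - b * Q) * (c / (a * b))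
                / ((1 - q * Q) * (1 - c * Q))"
      by (simp add: t_def qgauss_term_def qpochn_Suc s_def Q_def mult_ac)
    have "G (Suc m) = - (1 - c) * s * (1 - a * Q) * (1 - b * Q) * (c / (a * b)) / (1 - c * Q)"
      using nz unfolding G_def tS power_Suc Q_def[symmetric]
      by (simp add: divide_simps) (simp add: algebra_simps)
    moreover have "G m = (Q - 1) * (1 - c) * s"
      by (simp add: G_def t_def qgauss_term_def s_def Q_def)
    moreover have "t m = s"
      by (simp add: t_def qgauss_term_def s_def)
    moreover have "(1 - c) * (1 - c / (a * b)) * s
          - (1 - c / a) * (1 - c / b) * (s * Q * (1 - c) / (1 - c * Q))
        = - (1 - c) * s * (1 - a * Q) * (1 - b * Q) * (c / (a * b)) / (1 - c * Q)
          - (Q - 1) * (1 - c) * s"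
      using nz ab by (simp add: divide_simps) algebra
    ultimately show ?thesis
      by (simp add: t'm)
  qed
  \<comment> \<open>\<open>G 0 = 0\<close> because \<open>q ^ 0 = 1\<close>, and \<open>G\<close>
    tends to 0 with the summable \<open>t\<close>, so the telescoped series has sum 0.\<close>
  have "(\<lambda>m. (q ^ m - 1) * (1 - c) * t m) \<longlonglongrightarrow> (0 - 1) * (1 - c) * 0"
    using q by (intro tendsto_intros summable_LIMSEQ_zero t LIMSEQ_power_zero) auto
  then have "G \<longlonglongrightarrow> 0"
    by (simp add: G_def[abs_def])
  from telescope_sums[OF this]
  have "(\<lambda>m. (1 - c) * (1 - c / (a * b)) * t m - (1 - c / a) * (1 - c / b) * t' m) sums 0"
    by (simp add: step G_def)
  moreover have "(\<lambda>m. (1 - c) * (1 - c / (a * b)) * t m - (1 - c / a) * (1 - c / b) * t' m) sums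
      ((1 - c) * (1 - c / (a * b)) * suminf t - (1 - c / a) * (1 - c / b) * suminf t')"
    by (intro sums_diff sums_mult summable_sums t t')
  ultimately show ?thesis
    using sums_unique2 by (fastforce simp: t_def t'_def)
qed

text \<open>
  Iterating the contiguous relation replaces \<open>c\<close> by \<open>c * q ^ N\<close>; as \<open>N\<close> grows, only the term
  \<open>m = 0\<close> survives.
\<close>
theorem q_Gauss_sum:
  assumes q: "norm q < 1" and c: "\<And>j. c * q ^ j \<noteq> 1" and ab: "a \<noteq> 0" "b \<noteq> 0"
    and z: "norm (c / (a * b)) < 1"
  shows "(\<Sum>m. qgauss_term q a b c m) =
    qpoch_inf (c / a) q * qpoch_inf (c / b) q / (qpoch_inf c q * qpoch_inf (c / (a * b)) q)"
proof -
  define F where "F N = (\<Sum>m. qgauss_term q a b (c * q ^ N) m)" for N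
  define z where "z = c / (a * b)"
  have le1: "norm q ^ j \<le> 1" for j
    using q by (simp add: power_le_one)
  have zj: "norm (z * q ^ j) < 1" for j
    using z mult_mono[OF order_refl le1, of "norm z" j]
    by (simp add: z_def[symmetric] norm_mult norm_power)
  \<comment> \<open>The contiguous relation at \<open>c * q ^ N\<close> supplies precisely the next
    factor of each of the four finite products.\<close>
  have iter: "qpochn c q N * qpochn z q N * F 0 = qpochn (c / a) q N * qpochn (c / b) q N * F N" for N
  proof (induction N)
    case (Suc N)
    have "c * q ^ N * q ^ j \<noteq> 1" for j
      using c[of "N + j"] by (simp add: power_add mult.assoc)
    moreover have "norm (c * q ^ N / (a * b)) < 1"
      using zj[of N] by (simp add: z_def)
    ultimately have *: "(1 - c * q ^ N) * (1 - z * q ^ N) * F N =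
        (1 - c / a * q ^ N) * (1 - c / b * q ^ N) * F (Suc N)"
      using qgauss_contiguous[of q "c * q ^ N" a b] q ab by (simp add: F_def z_def mult_ac)
    have "qpochn c q (Suc N) * qpochn z q (Suc N) * F 0
        = (1 - c * q ^ N) * (1 - z * q ^ N) * (qpochn c q N * qpochn z q N * F 0)"
      by (simp add: qpochn_Suc mult_ac)
    also have "\<dots> = qpochn (c / a) q N * qpochn (c / b) q N * ((1 - c * q ^ N) * (1 - z * q ^ N) * F N)"
      unfolding Suc by (simp only: mult_ac)
    also have "\<dots> = qpochn (c / a) q (Suc N) * qpochn (c / b) q (Suc N) * F (Suc N)"
      unfolding * qpochn_Suc by (simp only: mult_ac)
    finally show ?case .
  qed simp
  obtain K where K: "\<And>N m. norm (qgauss_term q a b (c * q ^ N) m) \<le> K * norm z ^ m"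
    using norm_qgauss_term_le[OF q c] unfolding z_def by blast
  have q0: "(\<lambda>N. q ^ N) \<longlonglongrightarrow> 0"
    using q by (rule LIMSEQ_power_zero)
  have qnz: "qpochn q q m \<noteq> 0" for m
    by (rule qpochn_nonzero[OF q_power_neq_1[OF q]])
  have lim: "(\<lambda>N. qgauss_term q a b (c * q ^ N) m) \<longlonglongrightarrow> (if m = 0 then 1 else 0)" for m
  proof -
    have "(\<lambda>N. qpochn (c * q ^ N) q m) \<longlonglongrightarrow> (\<Prod>j<m. 1 - c * 0 * q ^ j)"
      unfolding qpochn_def by (intro tendsto_intros q0)
    then have "(\<lambda>N. qgauss_term q a b (c * q ^ N) m) \<longlonglongrightarrow>
        qpochn a q m * qpochn b q m * (c * 0 / (a * b)) ^ m / (qpochn q q m * (\<Prod>j<m. 1 - c * 0 * q ^ j))"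
      unfolding qgauss_term_def using ab qnz by (intro tendsto_intros q0) auto
    then show ?thesis
      by (cases "m = 0") (auto simp: power_0_left)
  qed
  \<comment> \<open>Tannery's theorem: the majorant \<open>K * norm z ^ m\<close> is free of
    \<open>N\<close>, so the limit may be taken termwise.\<close>
  have "F \<longlonglongrightarrow> (\<Sum>m. if m = 0 then 1 else 0)"
    unfolding F_def[abs_def]
    using tannerys_theorem[of "\<lambda>m N. qgauss_term q a b (c * q ^ N) m", OF lim,
        where M = "\<lambda>m. K * norm z ^ m"] K zj[of 0]
    by (auto intro!: summable_mult summable_geometric always_eventually)
  moreover have "(\<Sum>m. if m = (0::nat) then 1 else 0 :: complex) = 1"
    using sums_single[of 0 "\<lambda>_. 1 :: complex"] by (simp add: sums_iff)
  ultimately have F: "F \<longlonglongrightarrow> 1"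
    by simp
  have "(\<lambda>N. qpochn c q N * qpochn z q N * F 0) \<longlonglongrightarrow> qpoch_inf c q * qpoch_inf z q * F 0"
    by (intro tendsto_intros qpochn_tendsto q)
  moreover have "(\<lambda>N. qpochn c q N * qpochn z q N * F 0) \<longlonglongrightarrow>
      qpoch_inf (c / a) q * qpoch_inf (c / b) q * 1"
    unfolding iter by (intro tendsto_intros qpochn_tendsto q F)
  ultimately have "qpoch_inf c q * qpoch_inf z q * F 0 = qpoch_inf (c / a) q * qpoch_inf (c / b) q"
    using LIMSEQ_unique by fastforce
  moreover have "qpoch_inf c q \<noteq> 0"
    by (rule qpoch_inf_nonzero[OF q c])
  moreover have "qpoch_inf z q \<noteq> 0"
    using zj by (intro qpoch_inf_nonzero[OF q]) (metis norm_one less_irrefl)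
  ultimately show ?thesis
    by (simp add: F_def z_def field_simps)
qed

section \<open>The Bailey lemma\<close>

text \<open>The weight on the \<open>\<alpha>\<close>-side of Bailey's lemma relative to
  \<open>a = 1\<close>, with parameters \<open>x\<close> and \<open>y\<close>.\<close>

definition Bailey_weight :: "complex \<Rightarrow> complex \<Rightarrow> complex \<Rightarrow> nat \<Rightarrow> complex" where
  "Bailey_weight q x y k = qpochn x q k * qpochn y q k * (q / (x * y)) ^ k
     / (qpochn (q / x) q k * qpochn (q / y) q k)"

text \<open>With \<open>n = k + m\<close> the inner sum over \<open>m\<close> is a
  \<open>q\<close>-Gauss series with parameters \<open>x * q ^ k\<close>, \<open>y * q ^ k\<close>
  and \<open>q ^ (2 * k + 1)\<close>. Its argument \<open>q / (x * y)\<close> does not depend on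
  \<open>k\<close>, so the double series is dominated by a product of two one-variable
  series.\<close>

theorem Bailey_lemma:
  assumes q: "q \<noteq> 0" "norm q < 1" and xy: "x \<noteq> 0" "y \<noteq> 0"
    and z: "norm (q / (x * y)) < 1"
    and x: "\<And>j. q / x * q ^ j \<noteq> 1" and y: "\<And>j. q / y * q ^ j \<noteq> 1"
    and summable: "(\<lambda>k. Bailey_weight q x y k * A k) summable_on UNIV"
    and B: "\<And>n. B n = (\<Sum>k\<le>n. A k / (qpochn q q (n - k) * qpochn q q (n + k)))"
  shows "(\<lambda>n. qpochn x q n * qpochn y q n * (q / (x * y)) ^ n * B n) sums
    (qpoch_inf (q / x) q * qpoch_inf (q / y) q / (qpoch_inf q q * qpoch_inf (q / (x * y)) q) *
      (\<Sum>\<^sub>\<infinity>k. Bailey_weight q x y k * A k))"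
proof -
  define z where "z = q / (x * y)"
  define w where "w = Bailey_weight q x y"
  define K where "K = qpoch_inf (q / x) q * qpoch_inf (q / y) q / (qpoch_inf q q * qpoch_inf z q)"
  define D where "D n = qpochn x q n * qpochn y q n * z ^ n" for n
  define F where "F = (\<lambda>(k, m). A k * D (k + m) / (qpochn q q m * qpochn q q (2 * k + m)))"
  have qq: "q * q ^ j \<noteq> 1" for j
    by (rule q_power_neq_1[OF q(2)])
  have nz: "qpochn (q / x) q k \<noteq> 0" "qpochn (q / y) q k \<noteq> 0" for k
    by (rule qpochn_nonzero[OF x], rule qpochn_nonzero[OF y])
  have AD: "A k * D k = w k * A k * (qpochn (q / x) q k * qpochn (q / y) q k)" for k
    using nz[of k] by (simp add: D_def w_def Bailey_weight_def z_def)
  have split: "D (k + m) = D k * (qpochn (x * q ^ k) q m * qpochn (y * q ^ k) q m * z ^ m)" for k m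
    by (simp add: D_def qpochn_add power_add mult_ac)

  have inner: "((\<lambda>m. F (k, m)) has_sum K * (w k * A k)) UNIV" for k
  proof -
    define a b c where "a = x * q ^ k" and "b = y * q ^ k" and "c = q * q ^ (2 * k)"
    have c: "c * q ^ j \<noteq> 1" for j
      using qq[of "2 * k + j"] by (simp add: c_def power_add mult.assoc)
    have ab: "a \<noteq> 0" "b \<noteq> 0"
      using xy q by (auto simp: a_def b_def)
    have cab: "c / (a * b) = z" "c / a = q / x * q ^ k" "c / b = q / y * q ^ k"
      using xy q by (simp_all add: a_def b_def c_def z_def field_simps power_add mult_2_right)
    have zc: "norm (c / (a * b)) < 1"
      unfolding cab z_def by (rule z)
    note gauss = q_Gauss_sum[OF q(2) c ab zc, unfolded cab]
    note sm = summable_norm_qgauss_term[OF q(2) c zc]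
    have "(qgauss_term q a b c has_sum (\<Sum>m. qgauss_term q a b c m)) UNIV"
      by (rule norm_summable_imp_has_sum[OF sm summable_sums[OF summable_norm_cancel[OF sm]]])
    from has_sum_cmult_right[OF this, of "A k * D k / qpochn q q (2 * k)"]
    have "((\<lambda>m. A k * D k / qpochn q q (2 * k) * qgauss_term q a b c m) has_sum
        A k * D k / qpochn q q (2 * k) * (\<Sum>m. qgauss_term q a b c m)) UNIV" .
    moreover have "A k * D k / qpochn q q (2 * k) * qgauss_term q a b c m = F (k, m)" for m
      unfolding F_def split prod.case qpochn_add[of q q "2 * k"] qgauss_term_def cab(1)
      unfolding a_def b_def c_def by (simp add: mult_ac)
    \<comment> \<open>The finite products left over are exactly the initial segments of the infinite
      products in \<open>K\<close>: length \<open>k\<close> for \<open>q / x\<close> and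
      \<open>q / y\<close>, length \<open>2 * k\<close> for \<open>q\<close>.\<close>
    moreover have "A k * D k / qpochn q q (2 * k) * (\<Sum>m. qgauss_term q a b c m) = K * (w k * A k)"
      unfolding gauss AD K_def
      unfolding c_def
        qpoch_inf_split[OF q(2), of "q / x" k] qpoch_inf_split[OF q(2), of "q / y" k]
        qpoch_inf_split[OF q(2), of q "2 * k"]
      by (simp add: mult_ac)
    ultimately show ?thesis
      by simp
  qed

  have abs: "F abs_summable_on UNIV \<times> UNIV"
  proof -
    obtain c1 where c1: "c1 > 0" "\<And>n. c1 \<le> norm (qpochn q q n)"
      using norm_qpochn_lower_bound[OF q(2) qq] by blast
    define u where "u r = exp (r / (1 - norm q))" for r
    have u: "norm (qpochn d q n) \<le> u r" if "norm d \<le> r" for d n r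
      unfolding u_def using norm_qpochn_le[OF q(2)] that by simp
    have u_pos: "u r \<ge> 0" for r
      by (simp add: u_def)
    \<comment> \<open>Upper bounds for the four finite products produced by \<open>AD\<close> and
      \<open>split\<close>, over the lower bound \<open>c1\<close> for each of the two
      denominators.\<close>
    define C where "C = u (norm (q / x)) * u (norm (q / y)) * (u (norm x) * u (norm y)) / (c1 * c1)"
    have C: "C \<ge> 0"
      using c1 u_pos by (simp add: C_def)
    have le: "norm (d * q ^ k) \<le> norm d" for d k
      using q(2) by (simp add: norm_mult norm_power mult_left_le power_le_one)
    have bound: "norm (F (k, m)) \<le> C * norm (w k * A k) * norm z ^ m" for k m
    proof -
      have "norm (F (k, m)) = norm (w k * A k) * norm z ^ m *
          (norm (qpochn (q / x) q k) * norm (qpochn (q / y) q k) *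
           (norm (qpochn (x * q ^ k) q m) * norm (qpochn (y * q ^ k) q m))) /
          (norm (qpochn q q m) * norm (qpochn q q (2 * k + m)))"
        unfolding F_def split prod.case mult.assoc[symmetric, of "A k"] AD
        by (simp add: norm_mult norm_divide norm_power mult_ac)
      also have "\<dots> \<le> norm (w k * A k) * norm z ^ m *
          (u (norm (q / x)) * u (norm (q / y)) * (u (norm x) * u (norm y))) / (c1 * c1)"
        using c1 u_pos by (intro frac_le mult_mono mult_nonneg_nonneg mult_pos_pos u le order_refl) auto
      finally show ?thesis
        by (simp add: C_def mult_ac)
    qed
    have "summable (\<lambda>m. norm (norm z ^ m))"
      using z by (simp add: z_def summable_geometric)
    then have gz: "(\<lambda>m. norm z ^ m) summable_on UNIV"
      by (rule norm_summable_imp_summable_on)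
    \<comment> \<open>For complex families, unconditional and absolute summability coincide.\<close>
    have wA: "(\<lambda>k. norm (w k * A k)) summable_on UNIV"
      using summable unfolding w_def by (simp add: summable_on_iff_abs_summable_on_complex)
    have "(\<lambda>(k, m). C * norm (w k * A k) * norm z ^ m) abs_summable_on UNIV \<times> UNIV"
      unfolding abs_summable_on_Sigma_iff
      using C gz wA
      by (auto simp: abs_mult infsum_cmult_right' infsum_nonneg
               intro!: summable_on_cmult_right summable_on_cmult_left)
    then show ?thesis
      by (rule abs_summable_on_comparison_test) (use bound C in \<open>auto simp: abs_mult\<close>)
  qed

  have wA: "((\<lambda>k. K * (w k * A k)) has_sum K * (\<Sum>\<^sub>\<infinity>k. w k * A k)) UNIV"
    using summable unfolding w_def by (intro has_sum_cmult_right has_sum_infsum)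
  have "(F has_sum K * (\<Sum>\<^sub>\<infinity>k. w k * A k)) (UNIV \<times> UNIV)"
    by (rule has_sum_SigmaI[OF inner wA abs_summable_summable[OF abs]])
  \<comment> \<open>Regrouping by \<open>n = k + m\<close> leaves a finite sum over \<open>k\<close>
    at each \<open>n\<close>.\<close>
  also have "?this \<longleftrightarrow> ((\<lambda>(n, k). F (k, n - k)) has_sum K * (\<Sum>\<^sub>\<infinity>k. w k * A k))
      (SIGMA n:UNIV. {..n})"
    by (rule has_sum_reindex_bij_witness[of _ "\<lambda>(n, k). (k, n - k)" "\<lambda>(k, m). (k + m, k)"]) auto
  finally have "((\<lambda>n. \<Sum>k\<le>n. F (k, n - k)) has_sum K * (\<Sum>\<^sub>\<infinity>k. w k * A k)) UNIV"
    by (rule has_sum_SigmaD) (auto intro!: has_sum_finiteI)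
  \<comment> \<open>\<open>m = n - k\<close> turns \<open>2 * k + m\<close> into
    \<open>n + k\<close>, which gives the denominators of \<open>B\<close>.\<close>
  moreover have "(\<Sum>k\<le>n. F (k, n - k)) = D n * B n" for n
    unfolding B sum_distrib_left by (intro sum.cong) (auto simp: F_def mult_2 add_ac)
  ultimately show ?thesis
    unfolding D_def K_def w_def z_def by (simp add: has_sum_imp_sums)
qed

section \<open>From Bailey pairs relative to \<open>q\<close> to Bailey pairs relative to 1\<close>

text \<open>Each \<open>A k\<close> occurs at index \<open>k\<close> and, for \<open>k < n\<close>,
  at index \<open>k + 1\<close> of the sum. Over the common denominator its coefficients combine by
  \<open>(1 - b*u) * (1 - q*u^2*w) - u * (q*u - b) * (1 - w) = (1 - q*u^2) * (1 - b*u*w)\<close>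
  with \<open>u = q^k\<close> and \<open>w = q^(n-k)\<close>.\<close>

lemma Bailey_pair_q_to_1:
  assumes q: "norm q < 1"
    and B: "\<And>n. B n = (\<Sum>k\<le>n. A k / (qpochn q q (n - k) * qpochn q q (Suc (n + k))))"
  shows "(1 - b * q ^ n) * B n =
    (\<Sum>k\<le>n. ((1 - b * q ^ k) / (1 - q ^ (2 * k + 1)) * A k -
        (case k of 0 \<Rightarrow> 0 | Suc j \<Rightarrow> q ^ j * (q ^ Suc j - b) / (1 - q ^ (2 * j + 1)) * A j))
      / (qpochn q q (n - k) * qpochn q q (n + k)))"
proof -
  define f where "f k = (1 - b * q ^ k) / (1 - q ^ (2 * k + 1)) * A k" for k
  define g where "g k = q ^ k * (q ^ Suc k - b) / (1 - q ^ (2 * k + 1)) * A k" for k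
  define r where "r k = qpochn q q (n - k) * qpochn q q (n + k)" for k
  have nz: "1 - q * q ^ j \<noteq> 0" for j
    using q_power_neq_1[OF q, of j] by simp
  have coeff: "f k / r k - (if k < n then g k / r (Suc k) else 0) =
      (1 - b * q ^ n) * (A k / (qpochn q q (n - k) * qpochn q q (Suc (n + k))))"
    if "k \<le> n" for k
  proof -
    define d where "d = n - k"
    have n: "n = k + d"
      using that by (simp add: d_def)
    have nz': "1 - q * (q ^ k * q ^ k) \<noteq> 0" "1 - q * (q ^ k * (q ^ k * q ^ d)) \<noteq> 0"
      using nz[of "k + k"] nz[of "k + (k + d)"] by (simp_all add: power_add)
    \<comment> \<open>At \<open>k = n\<close> the shifted term lies outside the sum; there
      \<open>d = 0\<close> and \<open>1 - q ^ d\<close> vanishes, so one formula covers both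
      cases.\<close>
    have g: "(if k < n then g k / r (Suc k) else 0) =
        g k * (1 - q ^ d) / (qpochn q q d * qpochn q q (Suc (n + k)))"
    proof (cases d)
      case (Suc e)
      then show ?thesis
        using nz[of e] by (simp add: n r_def qpochn_Suc[of q q e])
    qed (simp add: n)
    have f: "f k / r k = f k * (1 - q * q ^ (n + k)) / (qpochn q q d * qpochn q q (Suc (n + k)))"
      using nz[of "n + k"] by (simp add: r_def d_def qpochn_Suc)
    have "f k * (1 - q * q ^ (n + k)) - g k * (1 - q ^ d) = (1 - b * q ^ n) * A k"
      using nz' unfolding f_def g_def n
      by (simp add: power_add mult_2 divide_simps) algebra
    then show ?thesis
      unfolding f g d_def[symmetric] by (simp flip: diff_divide_distrib)
  qed
  have "(\<Sum>k\<le>n. (f k - (case k of 0 \<Rightarrow> 0 | Suc j \<Rightarrow> g j)) / r k)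
      = (\<Sum>k\<le>n. f k / r k) - (\<Sum>k\<le>n. (case k of 0 \<Rightarrow> 0 | Suc j \<Rightarrow> g j) / r k)"
    by (simp add: diff_divide_distrib sum_subtractf)
  also have "(\<Sum>k\<le>n. (case k of 0 \<Rightarrow> 0 | Suc j \<Rightarrow> g j) / r k) = (\<Sum>k<n. g k / r (Suc k))"
    by (simp add: sum.atMost_shift)
  also have "\<dots> = (\<Sum>k\<le>n. if k < n then g k / r (Suc k) else 0)"
    by (rule sum.mono_neutral_cong_left) auto
  also have "(\<Sum>k\<le>n. f k / r k) - \<dots> = (1 - b * q ^ n) * B n"
    unfolding B sum_distrib_left sum_subtractf[symmetric] by (intro sum.cong coeff) auto
  finally show ?thesis
    unfolding f_def g_def r_def by (rule sym)
qed

section \<open>Folding the bilateral series\<close>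

text \<open>The index 0 is its own mirror image and must be counted once, hence the conditional. In
  a Banach space both half-families inherit summability.\<close>

lemma has_sum_fold_int:
  fixes f :: "int \<Rightarrow> 'a :: banach"
  assumes "f summable_on UNIV"
  shows "((\<lambda>n. f (int n) + (if n = 0 then 0 else f (- int n))) has_sum infsum f UNIV) UNIV"
proof -
  have "f summable_on {0..}" "f summable_on {..<0}"
    using summable_on_subset_banach[OF assms] by auto
  then have pos: "(f has_sum infsum f {0..}) {0..}" and neg: "(f has_sum infsum f {..<0}) {..<0}"
    by auto
  have "{0..} \<union> {..<0} = (UNIV :: int set)"
    by auto
  with has_sum_Un_disjoint[OF pos neg]
  have "(f has_sum infsum f {0..} + infsum f {..<0}) UNIV"
    by (metis disjoint_iff atLeast_iff lessThan_iff not_less)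
  then have total: "infsum f UNIV = infsum f {0..} + infsum f {..<0}"
    by (rule infsumI)
  from pos have pos': "((\<lambda>n. f (int n)) has_sum infsum f {0..}) UNIV"
    by (subst has_sum_reindex_bij_witness[of _ nat int "{0..}"]) auto
  from neg have "((\<lambda>n. f (- int n)) has_sum infsum f {..<0}) {1..}"
    by (subst has_sum_reindex_bij_witness[of _ "\<lambda>i. nat (- i)" "\<lambda>n. - int n" "{..<0}"]) auto
  also have "?this \<longleftrightarrow>
      ((\<lambda>n. if n = 0 then 0 else f (- int n)) has_sum infsum f {..<0}) UNIV"
    by (rule has_sum_cong_neutral) auto
  finally show ?thesis
    unfolding total by (rule has_sum_add[OF pos'])
qed

text \<open>
  The factors of both sides agree one by one, and a vanishing denominator on one side occurs
  together with one on the other, so that \<open>x\<close> is not restricted to avoid powers of \<open>q\<close>.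
\<close>
lemma qpoch_ratio_neg:
  assumes "q \<noteq> 0" "x \<noteq> 0"
  shows "qpoch x q (- int m) / qpoch (q / x) q (- int m) =
    (q / x ^ 2) ^ m * (qpochn x q m / qpochn (q / x) q m)"
proof (cases "m = 0")
  case False
  have powi: "q powi (- int (Suc j)) = inverse (q * q ^ j)" for j
    by (simp only: power_int_minus power_int_of_nat power_Suc)
  have factor: "(1 - q / x * q powi (- int (Suc j))) / (1 - x * q powi (- int (Suc j))) =
      q / x ^ 2 * ((1 - x * q ^ j) / (1 - q / x * q ^ j))" for j
  proof -
    have num: "1 - q / x * q powi (- int (Suc j)) = - (1 - x * q ^ j) / (x * q ^ j)"
      unfolding powi using assms by (simp add: field_simps)
    have den: "1 - x * q powi (- int (Suc j)) = - (1 - q / x * q ^ j) * x / (q * q ^ j)"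
      unfolding powi using assms by (simp add: field_simps)
    \<comment> \<open>Valid also for \<open>v = 0\<close>, where division by zero makes both sides
      0; this is how vanishing factors are carried along.\<close>
    have quot: "- u / (x * q ^ j) / (- v * x / (q * q ^ j)) = q / x ^ 2 * (u / v)" for u v
      using assms by (simp add: power2_eq_square mult_ac)
    show ?thesis
      unfolding num den quot ..
  qed
  have shift: "(\<Prod>j=1..m. f j) = (\<Prod>j<m. f (Suc j))" for f :: "nat \<Rightarrow> complex"
    by (rule prod.reindex_bij_witness[of _ Suc "\<lambda>j. j - 1"]) auto
  have "qpoch x q (- int m) / qpoch (q / x) q (- int m) =
      (\<Prod>j<m. (1 - q / x * q powi (- int (Suc j))) / (1 - x * q powi (- int (Suc j))))"
    using False by (simp add: qpoch_def shift prod_dividef del: of_nat_Suc One_nat_def)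
  also have "\<dots> = (q / x ^ 2) ^ m * (qpochn x q m / qpochn (q / x) q m)"
    unfolding factor qpochn_def by (simp add: prod_dividef prod.distrib power_divide)
  finally show ?thesis .
qed (simp add: qpoch_def)

text \<open>Evenness of the weight: inversion contributes \<open>q / x ^ 2\<close> and
  \<open>q / y ^ 2\<close> per factor, and their product divided by \<open>q / (x * y)\<close> is
  \<open>q / (x * y)\<close> again.\<close>

lemma summand_neg_weight:
  assumes "q \<noteq> 0" "x \<noteq> 0" "y \<noteq> 0"
  shows "qpoch x q (- int n) * qpoch y q (- int n) * (q / (x * y)) powi (- int n)
      / (qpoch (q / x) q (- int n) * qpoch (q / y) q (- int n)) = Bailey_weight q x y n"
proof -
  have "qpoch x q (- int n) * qpoch y q (- int n) * (q / (x * y)) powi (- int n)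
      / (qpoch (q / x) q (- int n) * qpoch (q / y) q (- int n))
    = qpoch x q (- int n) / qpoch (q / x) q (- int n)
      * (qpoch y q (- int n) / qpoch (q / y) q (- int n)) * (q / (x * y)) powi (- int n)"
    by simp
  also have "\<dots> = ((q / x ^ 2) ^ n * (q / y ^ 2) ^ n * inverse ((q / (x * y)) ^ n))
      * (qpochn x q n / qpochn (q / x) q n * (qpochn y q n / qpochn (q / y) q n))"
    unfolding qpoch_ratio_neg[OF assms(1,2)] qpoch_ratio_neg[OF assms(1,3)]
      power_int_minus power_int_of_nat by (simp only: mult_ac)
  also have "(q / x ^ 2) ^ n * (q / y ^ 2) ^ n * inverse ((q / (x * y)) ^ n)
      = (q / x ^ 2 * (q / y ^ 2) * inverse (q / (x * y))) ^ n"
    by (simp only: power_mult_distrib power_inverse)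
  also have "q / x ^ 2 * (q / y ^ 2) * inverse (q / (x * y)) = q / (x * y)"
    using assms by (simp add: power2_eq_square)
  finally show ?thesis
    by (simp add: Bailey_weight_def)
qed

text \<open>Reflection swaps the two coefficients of \<open>h\<close> up to sign: for
  \<open>k > 0\<close>, if \<open>h k = r * \<alpha> k - s * \<alpha> (k - 1)\<close>, then
  \<open>h (- k) = r * \<alpha> (- k - 1) - s * \<alpha> (- k)\<close>. Addition pairs the values of
  \<alpha> into \<open>A k\<close> and \<open>A (k - 1)\<close>.\<close>

lemma fold_coefficients:
  fixes q b :: complex and \<alpha> :: "int \<Rightarrow> complex"
  assumes q: "q \<noteq> 0" "norm q < 1"
  defines "h n \<equiv> (1 - b * q powi n) / (1 - q powi (2 * n + 1)) * \<alpha> n -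
      q powi (n - 1) * (q powi n - b) / (1 - q powi (2 * n - 1)) * \<alpha> (n - 1)"
  defines "A k \<equiv> \<alpha> (int k) + \<alpha> (- int k - 1)"
  shows "h (int k) + (if k = 0 then 0 else h (- int k)) =
    (1 - b * q ^ k) / (1 - q ^ (2 * k + 1)) * A k -
      (case k of 0 \<Rightarrow> 0 | Suc j \<Rightarrow> q ^ j * (q ^ Suc j - b) / (1 - q ^ (2 * j + 1)) * A j)"
proof (cases k)
  case 0
  \<comment> \<open>The single term at 0 already contains both \<open>\<alpha> 0\<close> and
    \<open>\<alpha> (- 1)\<close>; the identity below gives them the same coefficient.\<close>
  have "1 - q \<noteq> 0" "q - 1 \<noteq> 0"
    using q_power_neq_1[OF q(2), of 0] by auto
  then have "q powi (- 1) * (1 - b) / (1 - q powi (- 1)) = - ((1 - b) / (1 - q))"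
    using q by (simp add: power_int_minus divide_simps) algebra
  then show ?thesis
    by (simp add: 0 h_def A_def ring_distribs)
next
  case (Suc j)
  \<comment> \<open>All exponents are expressed through \<open>p = q ^ (k - 1)\<close>, so that only
    rational identities in \<open>q\<close>, \<open>p\<close> and \<open>b\<close> remain.\<close>
  define p where "p = q ^ j"
  have p: "p \<noteq> 0"
    using q by (simp add: p_def)
  have pow: "q powi (int k) = q * p" "q powi (2 * int k + 1) = q ^ 3 * p ^ 2"
    "q powi (int k - 1) = p" "q powi (2 * int k - 1) = q * p ^ 2" "q powi (- int k - 1) = 1 / (q ^ 2 * p)"
    "q powi (- int k) = 1 / (q * p)" "q powi (2 * - int k + 1) = 1 / (q * p ^ 2)"
    "q powi (2 * - int k - 1) = 1 / (q ^ 3 * p ^ 2)"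
  proof -
    have *: "q powi i = q ^ n" "q powi (- i) = 1 / q ^ n" if "i = int n" for i n
      using that by (simp_all add: power_int_minus divide_inverse)
    have e1: "q ^ (j + 1) = q * p" "q ^ (j * 2 + 3) = q ^ 3 * p ^ 2" "q ^ (j * 2 + 1) = q * p ^ 2"
      "q ^ (j + 2) = q ^ 2 * p"
      by (simp_all add: p_def power_add power_mult mult.commute flip: power2_eq_square)
    show "q powi (int k) = q * p" using *(1)[of _ "j + 1"] Suc e1 by simp
    show "q powi (2 * int k + 1) = q ^ 3 * p ^ 2"
      using *(1)[of "2 * int k + 1" "j * 2 + 3"] Suc e1 by simp
    show "q powi (int k - 1) = p" using *(1)[of "int k - 1" "j"] Suc p_def by simp
    show "q powi (2 * int k - 1) = q * p ^ 2"
      using *(1)[of "2 * int k - 1" "j * 2 + 1"] Suc e1 by simp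
    show "q powi (- int k - 1) = 1 / (q ^ 2 * p)"
      using *(2)[of "int k + 1" "j + 2"] Suc e1 by simp
    show "q powi (- int k) = 1 / (q * p)"
      using *(2)[of "int k" "j + 1"] Suc e1 by simp
    show "q powi (2 * - int k + 1) = 1 / (q * p ^ 2)"
      using *(2)[of "2 * int k - 1" "j * 2 + 1"] Suc e1 by simp
    show "q powi (2 * - int k - 1) = 1 / (q ^ 3 * p ^ 2)"
      using *(2)[of "2 * int k + 1" "j * 2 + 3"] Suc e1 by simp
  qed
  have c1: "(1 - b * (1 / (q * p))) / (1 - 1 / (q * p ^ 2)) = - (p * (q * p - b) / (1 - q * p ^ 2))"
  proof -
    have num: "1 - b * (1 / (q * p)) = (q * p - b) / (q * p)"
      and den: "1 - 1 / (q * p ^ 2) = - (1 - q * p ^ 2) / (q * p ^ 2)"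
      using q p by (simp_all add: field_simps)
    have quot: "u / (q * p) / (- v / (q * p ^ 2)) = - (p * u / v)" for u v
      using q p by (simp add: power2_eq_square mult_ac)
    show ?thesis
      unfolding num den quot ..
  qed
  have c2: "1 / (q ^ 2 * p) * (1 / (q * p) - b) / (1 - 1 / (q ^ 3 * p ^ 2))
      = - ((1 - b * (q * p)) / (1 - q ^ 3 * p ^ 2))"
  proof -
    have num: "1 / (q * p) - b = (1 - b * (q * p)) / (q * p)"
      and den: "1 - 1 / (q ^ 3 * p ^ 2) = - (1 - q ^ 3 * p ^ 2) / (q ^ 3 * p ^ 2)"
      using q p by (simp_all add: field_simps)
    have quot: "1 / (q ^ 2 * p) * (u / (q * p)) / (- v / (q ^ 3 * p ^ 2)) = - (u / v)" for u v
      using q p by (simp add: power2_eq_square power3_eq_cube mult_ac)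
    show ?thesis
      unfolding num den quot ..
  qed
  have hp: "h (int k) = (1 - b * (q * p)) / (1 - q ^ 3 * p ^ 2) * \<alpha> (int k)
      - p * (q * p - b) / (1 - q * p ^ 2) * \<alpha> (int j)"
    unfolding h_def pow by (simp add: Suc)
  have j: "- int k = - int j - 1"
    by (simp add: Suc)
  have hn: "h (- int k) = - (p * (q * p - b) / (1 - q * p ^ 2)) * \<alpha> (- int j - 1)
      + (1 - b * (q * p)) / (1 - q ^ 3 * p ^ 2) * \<alpha> (- int k - 1)"
    unfolding h_def pow c1 c2 by (simp add: j)
  have e: "q ^ k = q * p" "q ^ (2 * k + 1) = q ^ 3 * p ^ 2"
    by (simp_all add: Suc p_def mult_2 power_add power2_eq_square power3_eq_cube)
  have "q ^ (2 * j + 1) = q * p ^ 2"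
    by (simp add: p_def mult_2 power_add power2_eq_square)
  then have prev: "(case k of 0 \<Rightarrow> 0 | Suc j \<Rightarrow> q ^ j * (q ^ Suc j - b) / (1 - q ^ (2 * j + 1)) * A j)
      = p * (q * p - b) / (1 - q * p ^ 2) * A j"
    by (simp add: Suc p_def)
  have regroup: "r * a - s * a' + (- s * d' + r * d) = r * (a + d) - s * (a' + d')"
    for r s a a' d d' :: complex
    by (simp add: algebra_simps)
  have "k \<noteq> 0"
    by (simp add: Suc)
  then show ?thesis
    unfolding hp hn prev e unfolding A_def by (simp only: if_False regroup)
qed

text \<open>Substituting \<open>- k - 1\<close> for \<open>k\<close> swaps \<open>n - k\<close> and
  \<open>n + k + 1\<close>, so the two terms share their denominator and the range folds onto
  \<open>0..n\<close>.\<close>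

lemma asym_bilateral_Bailey_pair_fold:
  assumes "asym_bilateral_Bailey_pair q \<alpha> \<beta>"
  shows "\<beta> n = (\<Sum>k\<le>n. (\<alpha> (int k) + \<alpha> (- int k - 1))
      / (qpochn q q (n - k) * qpochn q q (Suc (n + k))))"
proof -
  define f where "f k = \<alpha> k / (qpoch q q (int n - k) * qpoch q q (int n + k + 1))" for k
  have fp: "f (int k) = \<alpha> (int k) / (qpochn q q (n - k) * qpochn q q (Suc (n + k)))"
    and fn: "f (- int k - 1) = \<alpha> (- int k - 1) / (qpochn q q (n - k) * qpochn q q (Suc (n + k)))"
    if "k \<le> n" for k
  proof -
    have *: "qpoch q q (int n - int k) = qpochn q q (n - k)"
      "qpoch q q (int n + int k + 1) = qpochn q q (Suc (n + k))"
      using that by (simp_all add: of_nat_diff add_ac flip: qpoch_of_nat)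
    then show "f (int k) = \<alpha> (int k) / (qpochn q q (n - k) * qpochn q q (Suc (n + k)))"
      by (simp add: f_def)
    have "int n - (- int k - 1) = int n + int k + 1" "int n + (- int k - 1) + 1 = int n - int k"
      by simp_all
    then show "f (- int k - 1) = \<alpha> (- int k - 1) / (qpochn q q (n - k) * qpochn q q (Suc (n + k)))"
      unfolding f_def by (simp only: * mult.commute)
  qed
  have "\<beta> n = sum f {- int n - 1..int n}"
    using assms by (simp add: asym_bilateral_Bailey_pair_def f_def)
  also have "{- int n - 1..int n} = {0..int n} \<union> {- int n - 1..-1}"
    by auto
  also have "sum f \<dots> = sum f {0..int n} + sum f {- int n - 1..-1}"
    by (rule sum.union_disjoint) auto
  also have "sum f {0..int n} = (\<Sum>k\<le>n. f (int k))"
    by (rule sum.reindex_bij_witness[of _ int nat]) auto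
  also have "sum f {- int n - 1..-1} = (\<Sum>k\<le>n. f (- int k - 1))"
    by (rule sum.reindex_bij_witness[of _ "\<lambda>k. - int k - 1" "\<lambda>i. nat (- i - 1)"]) auto
  also have "(\<Sum>k\<le>n. f (int k)) + (\<Sum>k\<le>n. f (- int k - 1)) =
      (\<Sum>k\<le>n. (\<alpha> (int k) + \<alpha> (- int k - 1)) / (qpochn q q (n - k) * qpochn q q (Suc (n + k))))"
    unfolding sum.distrib[symmetric] by (rule sum.cong) (simp_all only: fp fn atMost_iff add_divide_distrib)
  finally show ?thesis .
qed

section \<open>The bilateral transformation formula\<close>

theorem lemma2p7:
  fixes q b x y :: complex and \<alpha> :: "int \<Rightarrow> complex" and \<beta> :: "nat \<Rightarrow> complex"
  assumes q: "0 < norm q" "norm q < 1"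
    and xy: "x \<noteq> 0" "y \<noteq> 0" "norm (q / (x * y)) < 1"
    and x_notin: "x \<notin> {q ^ m | m::nat. m \<ge> 1}"
    and y_notin: "y \<notin> {q ^ m | m::nat. m \<ge> 1}"
    and pair: "asym_bilateral_Bailey_pair q \<alpha> \<beta>"
    and conv_left: "summable (\<lambda>n::nat. norm
          (qpoch x q (int n) * qpoch y q (int n) * (1 - b * q ^ n) * (q / (x * y)) ^ n * \<beta> n))"
    and conv_right: "(\<lambda>n::int. norm
          (qpoch x q n * qpoch y q n * (q / (x * y)) powi n / (qpoch (q / x) q n * qpoch (q / y) q n) *
            ((1 - b * q powi n) / (1 - q powi (2 * n + 1)) * \<alpha> n -
             q powi (n - 1) * (q powi n - b) / (1 - q powi (2 * n - 1)) * \<alpha> (n - 1))))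
          summable_on UNIV"
  shows "(\<Sum>n::nat. qpoch x q (int n) * qpoch y q (int n) * (1 - b * q ^ n) * (q / (x * y)) ^ n * \<beta> n) =
    qpoch_inf (q / x) q * qpoch_inf (q / y) q / (qpoch_inf q q * qpoch_inf (q / (x * y)) q) *
    (\<Sum>\<^sub>\<infinity>n::int.
       qpoch x q n * qpoch y q n * (q / (x * y)) powi n / (qpoch (q / x) q n * qpoch (q / y) q n) *
         ((1 - b * q powi n) / (1 - q powi (2 * n + 1)) * \<alpha> n -
          q powi (n - 1) * (q powi n - b) / (1 - q powi (2 * n - 1)) * \<alpha> (n - 1)))"
proof -
  define A where "A k = \<alpha> (int k) + \<alpha> (- int k - 1)" for k
  define A1 where "A1 k = (1 - b * q ^ k) / (1 - q ^ (2 * k + 1)) * A k -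
      (case k of 0 \<Rightarrow> 0 | Suc j \<Rightarrow> q ^ j * (q ^ Suc j - b) / (1 - q ^ (2 * j + 1)) * A j)" for k
  define h where "h n = (1 - b * q powi n) / (1 - q powi (2 * n + 1)) * \<alpha> n -
      q powi (n - 1) * (q powi n - b) / (1 - q powi (2 * n - 1)) * \<alpha> (n - 1)" for n
  define w where "w n = qpoch x q n * qpoch y q n * (q / (x * y)) powi n
      / (qpoch (q / x) q n * qpoch (q / y) q n)" for n
  have q0: "q \<noteq> 0"
    using q by auto
  have w: "w (int k) = Bailey_weight q x y k" "w (- int k) = Bailey_weight q x y k" for k
    using summand_neg_weight[OF q0 xy(1,2)] by (simp_all add: w_def Bailey_weight_def qpoch_of_nat)
  have "w (int k) * h (int k) + (if k = 0 then 0 else w (- int k) * h (- int k))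
      = Bailey_weight q x y k * A1 k" for k
    using fold_coefficients[OF q0 q(2), where k = k and b = b and \<alpha> = \<alpha>]
    unfolding w A1_def A_def h_def by (cases "k = 0") (simp_all only: if_True if_False simp_thms
      add_0_right flip: distrib_left)
  moreover have "(\<lambda>n. w n * h n) summable_on UNIV"
    using conv_right unfolding w_def h_def by (rule abs_summable_summable)
  ultimately have bilateral:
    "((\<lambda>k. Bailey_weight q x y k * A1 k) has_sum (\<Sum>\<^sub>\<infinity>n. w n * h n)) UNIV"
    using has_sum_fold_int[of "\<lambda>n. w n * h n"] by simp
  \<comment> \<open>Excluding the powers \<open>q ^ m\<close> with \<open>m \<ge> 1\<close> is
    exactly what keeps the factors of \<open>qpochn (q / u) q\<close> away from 0, with
    \<open>m = j + 1\<close>.\<close>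
  have neq: "q / u * q ^ j \<noteq> 1" if "u \<notin> {q ^ m | m::nat. m \<ge> 1}" "u \<noteq> 0" for u j
  proof
    assume "q / u * q ^ j = 1"
    then have "u = q ^ Suc j"
      using that(2) by (simp add: field_simps)
    then have "\<exists>m\<ge>1. u = q ^ m"
      by (intro exI[of _ "Suc j"]) simp
    then show False
      using that(1) by (simp add: conj_commute)
  qed
  \<comment> \<open>The factor \<open>1 - b * q ^ n\<close> is absorbed into the
    \<open>\<beta>\<close>-side here; the Bailey lemma itself does not involve
    \<open>b\<close>.\<close>
  have pair1: "(1 - b * q ^ n) * \<beta> n =
      (\<Sum>k\<le>n. A1 k / (qpochn q q (n - k) * qpochn q q (n + k)))" for n
    unfolding A1_def
    by (rule Bailey_pair_q_to_1[OF q(2)])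
       (simp add: A_def asym_bilateral_Bailey_pair_fold[OF pair])
  have "(\<lambda>n. qpochn x q n * qpochn y q n * (q / (x * y)) ^ n * ((1 - b * q ^ n) * \<beta> n)) sums
    (qpoch_inf (q / x) q * qpoch_inf (q / y) q / (qpoch_inf q q * qpoch_inf (q / (x * y)) q) *
      (\<Sum>\<^sub>\<infinity>k. Bailey_weight q x y k * A1 k))"
    by (rule Bailey_lemma[OF q0 q(2) xy neq[OF x_notin xy(1)] neq[OF y_notin xy(2)] _ pair1])
       (use bilateral in \<open>auto simp: summable_on_def\<close>)
  then show ?thesis
    unfolding infsumI[OF bilateral] w_def h_def qpoch_of_nat
    by (simp add: sums_iff mult_ac)
qed

end
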